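(* Every pre-Wajsberg algebra is a meta-Wajsberg algebra. That is, if $X$ is an involutive BE algebra satisfying $x\to (x\Cap y)=x\to y$ for all $x,y\in X$, then $(x\Cap y)\to (y\Cap x)=1$ for all $x,y\in X$.
   Context: A BE algebra is an algebra $(X,\to,1)$ of type $(2,0)$ such that for all $x,y,z\in X$: $x\to x=1$; $x\to 1=1$; $1\to x=x$; $x\to (y\to z)=y\to (x\to z)$. Write $x\le y$ iff $x\to y=1$. It is bounded if there is $0\in X$ with $0\le x$ for all $x\in X$; then $x^*:=x\to 0$. It is involutive if it is bounded and $x^{**}=x$ for all $x\in X$; an involutive BE algebra is denoted $(X,\to,^*,1)$. In an involutive BE algebra define $x\Cup y=(x\to y)\to y$ and $x\Cap y=((x^*\to y^* )\to y^* )^*$. A pre-Wajsberg algebra is an involutive BE algebra satisfying $x\to (x\Cap y)=x\to y$ for all $x,y$. A meta-Wajsberg algebra is an involutive BE algebra satisfying $(x\Cap y)\to (y\Cap x)=1$ for all $x,y$. *)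

theory Defs
  imports Main
begin

locale be_algebra =
  fixes X :: "'a set"
    and imp :: "'a \<Rightarrow> 'a \<Rightarrow> 'a" (infixr "\<leadsto>" 70)
    and one :: 'a ("\<one>")
  assumes one_closed: "\<one> \<in> X"
    and imp_closed: "x \<in> X \<Longrightarrow> y \<in> X \<Longrightarrow> x \<leadsto> y \<in> X"
    and imp_self: "x \<in> X \<Longrightarrow> x \<leadsto> x = \<one>"
    and imp_one: "x \<in> X \<Longrightarrow> x \<leadsto> \<one> = \<one>"
    and one_imp: "x \<in> X \<Longrightarrow> \<one> \<leadsto> x = x"
    and imp_exchange:
      "x \<in> X \<Longrightarrow> y \<in> X \<Longrightarrow> z \<in> X \<Longrightarrow> x \<leadsto> (y \<leadsto> z) = y \<leadsto> (x \<leadsto> z)"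
begin

definition le :: "'a \<Rightarrow> 'a \<Rightarrow> bool" (infix "\<preceq>" 50)
  where "x \<preceq> y \<longleftrightarrow> x \<leadsto> y = \<one>"

end

text \<open>The order need not be antisymmetric, so a BE algebra may have several bottom
  elements. The one that defines the complement is therefore a parameter.\<close>

locale bounded_be_algebra = be_algebra +
  fixes zero :: 'a ("\<zero>")
  assumes zero_closed: "\<zero> \<in> X"
    and zero_le: "x \<in> X \<Longrightarrow> \<zero> \<preceq> x"
begin

definition star :: "'a \<Rightarrow> 'a" ("_\<^sup>\<star>" [1000] 1000)
  where "x\<^sup>\<star> = x \<leadsto> \<zero>"

end

locale involutive_be_algebra = bounded_be_algebra +
  assumes star_star: "x \<in> X \<Longrightarrow> (x\<^sup>\<star>)\<^sup>\<star> = x"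
begin

definition Cap :: "'a \<Rightarrow> 'a \<Rightarrow> 'a" (infixl "\<Cap>" 75)
  where "x \<Cap> y = ((x\<^sup>\<star> \<leadsto> y\<^sup>\<star>) \<leadsto> y\<^sup>\<star>)\<^sup>\<star>"

end

locale pre_wajsberg_algebra = involutive_be_algebra +
  assumes pre_wajsberg: "x \<in> X \<Longrightarrow> y \<in> X \<Longrightarrow> x \<leadsto> (x \<Cap> y) = x \<leadsto> y"

locale meta_wajsberg_algebra = involutive_be_algebra +
  assumes meta_wajsberg: "x \<in> X \<Longrightarrow> y \<in> X \<Longrightarrow> (x \<Cap> y) \<leadsto> (y \<Cap> x) = \<one>"

end

(* By contraposition the pre-Wajsberg law reads ((b -> a) -> a) -> b = a -> b.
   The meta-Wajsberg law becomes ((b -> a) -> a) -> ((a -> b) -> b) = 1 with a, b complements;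
   exchanging the premises turns it into (a -> b) -> (a -> b) = 1. *)
theory Submission
  imports Defs
begin

context involutive_be_algebra
begin

lemma star_closed: "x \<in> X \<Longrightarrow> x\<^sup>\<star> \<in> X"
  by (simp add: star_def imp_closed zero_closed)

text \<open>As \<open>y\<^sup>\<star>\<close> is an implication into \<open>\<zero>\<close>,
  exchange brings \<open>y\<close> to the front and leaves the double complement of \<open>x\<close>
  behind it.\<close>

lemma contraposition:
  assumes "x \<in> X" "y \<in> X"
  shows "x\<^sup>\<star> \<leadsto> y\<^sup>\<star> = y \<leadsto> x"
proof -
  have "x\<^sup>\<star> \<leadsto> y\<^sup>\<star> = y \<leadsto> (x\<^sup>\<star>)\<^sup>\<star>"
    using imp_exchange[of "x\<^sup>\<star>" y \<zero>] assms star_closed zero_closed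
    by (simp add: star_def)
  then show ?thesis
    using assms star_star by simp
qed

text \<open>Both meets are complements, so contraposition strips the outer stars and swaps the two
  sides.\<close>

lemma Cap_imp_Cap:
  assumes "x \<in> X" "y \<in> X"
  shows "(x \<Cap> y) \<leadsto> (y \<Cap> x) =
    ((y\<^sup>\<star> \<leadsto> x\<^sup>\<star>) \<leadsto> x\<^sup>\<star>) \<leadsto> ((x\<^sup>\<star> \<leadsto> y\<^sup>\<star>) \<leadsto> y\<^sup>\<star>)"
  unfolding Cap_def by (rule contraposition) (simp_all add: assms star_closed imp_closed)

end

context pre_wajsberg_algebra
begin

lemma pre_wajsberg_dual:
  assumes "a \<in> X" "b \<in> X"
  shows "((b \<leadsto> a) \<leadsto> a) \<leadsto> b = a \<leadsto> b"
proof -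
  \<comment> \<open>At complements the inner stars of the meet cancel by involution; only the outer
    one survives, ready for contraposition.\<close>
  have "b\<^sup>\<star> \<leadsto> ((b \<leadsto> a) \<leadsto> a)\<^sup>\<star> = b\<^sup>\<star> \<leadsto> a\<^sup>\<star>"
    using pre_wajsberg[of "b\<^sup>\<star>" "a\<^sup>\<star>"] assms star_closed star_star
    by (simp add: Cap_def)
  then show ?thesis
    using assms by (simp add: contraposition imp_closed)
qed

lemma Cup_imp_Cup:
  assumes "a \<in> X" "b \<in> X"
  shows "((b \<leadsto> a) \<leadsto> a) \<leadsto> ((a \<leadsto> b) \<leadsto> b) = \<one>"
proof -
  have "((b \<leadsto> a) \<leadsto> a) \<leadsto> ((a \<leadsto> b) \<leadsto> b) = (a \<leadsto> b) \<leadsto> (((b \<leadsto> a) \<leadsto> a) \<leadsto> b)"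
    by (rule imp_exchange) (simp_all add: assms imp_closed)
  also have "\<dots> = \<one>"
    using assms by (simp add: pre_wajsberg_dual imp_self imp_closed)
  finally show ?thesis .
qed

end

theorem proposition3p3:
  fixes X :: "'a set" and imp :: "'a \<Rightarrow> 'a \<Rightarrow> 'a" and one zero :: 'a
  assumes "pre_wajsberg_algebra X imp one zero"
  shows "meta_wajsberg_algebra X imp one zero"
proof -
  interpret pre_wajsberg_algebra X imp one zero
    by (rule assms)
  show ?thesis
    \<comment> \<open>\<open>Cup_imp_Cup\<close> applies with \<open>x\<^sup>\<star>\<close> for
      \<open>a\<close> and \<open>y\<^sup>\<star>\<close> for \<open>b\<close>.\<close>
    by unfold_locales (simp add: Cap_imp_Cap Cup_imp_Cup star_closed)
qed

end
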